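(* Let $p,k$ be positive integers and let $(\mathbf{A}_n)_{n\in\mathbb{N}}$ be a sequence of matrices in $\mathbb{C}^{p\times p}$ defining a $Fib_p^k$ recurrence, i.e. $\mathbf{A}_{k-1}\neq \mathbf{0}$ and $\mathbf{A}_n=\mathbf{0}$ for all $n\ge k$. Let $\mathbf{F}\in\mathbb{C}^{kp\times kp}$ be its Frobenius companion matrix and $\mathbf{K}$ its kneading matrix. Then $$\det(\mathbf{I}-z\mathbf{F})=\det(\mathbf{I}-z\mathbf{K}).$$
   Context: $\mathbb{N}=\{0,1,2,\dots\}$. A sequence $(\mathbf{A}_n)_{n\in\mathbb{N}}$ of complex $p\times p$ matrices determines the linear recurrence (called a $Fib_p$ recurrence) $\mathrm{x}_{n+1}=\sum_{i=0}^{+\infty}\mathbf{A}_i\mathrm{x}_{n-i}$, $n\in\mathbb{N}$, where $\mathrm{x}_n\in\mathbb{C}^p$ for all $n\in\mathbb{Z}$ and $\mathrm{x}_n=0$ for all but finitely many negative $n$. It is of finite order $k$ (a $Fib_p^k$ recurrence) if $k\ge 1$, $\mathbf{A}_{k-1}\ne\mathbf{0}$ and $\mathbf{A}_n=\mathbf{0}$ for $n\ge k$. The Frobenius companion matrix of a $Fib_p^k$ recurrence is the $kp\times kp$ block matrix $$\mathbf{F}=\begin{pmatrix}\mathbf{A}_0&\cdots&\mathbf{A}_{k-2}&\mathbf{A}_{k-1}\\ \mathbf{I}&\cdots&\mathbf{0}&\mathbf{0}\\ \vdots&\ddots&\vdots&\vdots\\ \mathbf{0}&\cdots&\mathbf{I}&\mathbf{0}\end{pmatrix},$$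 where the blocks are $p\times p$, $\mathbf{I}$ is the identity and $\mathbf{0}$ the zero matrix (first block row $\mathbf{A}_0,\dots,\mathbf{A}_{k-1}$, identity blocks on the block subdiagonal, zeros elsewhere). The kneading matrix is the $p\times p$ matrix $\mathbf{K}=(K(i,j))$ over the ring $\mathbb{C}[[z]]$ of formal power series with $K(i,j)=\sum_{n\ge0}A_n(i,j)z^n$, where $A_n(i,j)$ is the $(i,j)$ entry of $\mathbf{A}_n$ (for a $Fib_p^k$ recurrence its entries are polynomials). In each determinant $\mathbf{I}$ denotes the identity matrix of the appropriate size. *)

theory Defs
  imports
    "Jordan_Normal_Form.Determinant"
    "HOL-Computational_Algebra.Formal_Power_Series"
begin

(* The coefficient sequence determines the recurrence
   x (n + 1) = A 0 x n + A 1 x (n - 1) + ..., so the sequence itself stands for it. *)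
definition fib_recurrence :: "nat \<Rightarrow> (nat \<Rightarrow> complex mat) \<Rightarrow> bool" where
  "fib_recurrence p A \<longleftrightarrow> (\<forall>n. A n \<in> carrier_mat p p)"

definition fib_recurrence_order :: "nat \<Rightarrow> nat \<Rightarrow> (nat \<Rightarrow> complex mat) \<Rightarrow> bool" where
  "fib_recurrence_order p k A \<longleftrightarrow>
     fib_recurrence p A \<and> k \<ge> 1 \<and> A (k - 1) \<noteq> 0\<^sub>m p p \<and> (\<forall>n\<ge>k. A n = 0\<^sub>m p p)"

(* Row r of the kp x kp matrix is row r mod p of block row r div p; columns likewise. *)
definition frobenius_companion :: "nat \<Rightarrow> nat \<Rightarrow> (nat \<Rightarrow> complex mat) \<Rightarrow> complex mat" where
  "frobenius_companion p k A = mat (k * p) (k * p) (\<lambda>(r, c).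
     (if r div p = 0 then A (c div p)
      else if r div p = c div p + 1 then 1\<^sub>m p
      else 0\<^sub>m p p) $$ (r mod p, c mod p))"

definition kneading_matrix :: "nat \<Rightarrow> (nat \<Rightarrow> complex mat) \<Rightarrow> complex fps mat" where
  "kneading_matrix p A = mat p p (\<lambda>(i, j). Abs_fps (\<lambda>n. A n $$ (i, j)))"

end

(* Multiply I - zF on the right by the block lower unitriangular matrix U whose (i, j) block is
   z^(i-j) I for i >= j. Below the first block row, block row i of I - zF is (..., -zI, I, ...),
   so the product telescopes to the identity there, while the first block column collects
   I - z (A_0 + z A_1 + ... + z^(k-1) A_(k-1)) = I - zK. Hence (I - zF) U is block upper
   triangular with diagonal blocks I - zK, I, ..., I, and det U = 1. *)
theory Submission imports Defs begin

text \<open>Equal residues mod \<open>p\<close> mean the diagonal of a block, and there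
  \<open>(r - c) div p\<close> is the block distance. For positive \<open>p\<close> this is the
  inverse of I - zS, where S has ones exactly on the \<open>p\<close>-th subdiagonal.\<close>

definition geometric_block_mat :: "nat \<Rightarrow> nat \<Rightarrow> complex fps mat" where
  "geometric_block_mat n p =
     mat n n (\<lambda>(r, c). if c \<le> r \<and> r mod p = c mod p then fps_X ^ ((r - c) div p) else 0)"

lemma geometric_block_mat_carrier [simp]: "geometric_block_mat n p \<in> carrier_mat n n"
  by (simp add: geometric_block_mat_def)

lemma det_geometric_block_mat: "det (geometric_block_mat n p) = 1"
proof -
  have "det (geometric_block_mat n p) = prod_list (diag_mat (geometric_block_mat n p))"
    by (rule det_lower_triangular[of n]) (auto simp: geometric_block_mat_def)
  also have "diag_mat (geometric_block_mat n p) = replicate n 1"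
    by (rule nth_equalityI) (auto simp: diag_mat_def geometric_block_mat_def)
  finally show ?thesis by simp
qed

text \<open>Going down \<open>p\<close> rows in a column raises the exponent by one, so the two
  terms cancel. On the diagonal nothing cancels, because row \<open>r - p\<close> lies above the
  diagonal there.\<close>

lemma geometric_block_mat_telescope:
  assumes "p \<ge> 1" "p \<le> r" "r < n" "c < n"
  shows "geometric_block_mat n p $$ (r, c) - fps_X * geometric_block_mat n p $$ (r - p, c)
       = (if r = c then 1 else 0)"
proof (cases "c \<le> r \<and> r mod p = c mod p")
  case True
  have mod_eq: "(r - p) mod p = r mod p"
    using assms by (simp add: le_mod_geq)
  show ?thesis
  proof (cases "r = c")
    case True
    then show ?thesis using assms by (auto simp: geometric_block_mat_def)
  next
    case False
    have "p dvd r - c"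
      using True by (metis mod_eq_dvd_iff_nat)
    then have "p \<le> r - c"
      using True False by (intro dvd_imp_le) auto
    moreover from this have "(r - c) div p = Suc ((r - p - c) div p)"
      using assms le_div_geq[of p "r - c"] diff_commute[of r c p] by simp
    ultimately show ?thesis
      using True False assms mod_eq by (auto simp: geometric_block_mat_def)
  qed
next
  case False
  then have "\<not> (c \<le> r - p \<and> (r - p) mod p = c mod p)"
    using assms by (auto simp: le_mod_geq)
  then show ?thesis
    using False assms by (auto simp: geometric_block_mat_def)
qed

text \<open>Passes from flat indices to block indices: since \<open>c < p\<close>, the map
  \<open>s \<mapsto> s div p\<close> is a bijection from the indices with residue \<open>c\<close>
  onto the blocks.\<close>

lemma sum_lessThan_mult_residue:
  fixes f :: "nat \<Rightarrow> 'a :: comm_monoid_add"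
  assumes "c < p"
  shows "(\<Sum>s<k * p. if s mod p = c then f s else 0) = (\<Sum>l<k. f (l * p + c))"
proof -
  have "(\<Sum>s<k * p. if s mod p = c then f s else 0) = (\<Sum>s | s < k * p \<and> s mod p = c. f s)"
    by (rule sum.mono_neutral_cong_right) auto
  also have "\<dots> = (\<Sum>l<k. f (l * p + c))"
  proof (rule sum.reindex_bij_witness[of _ "\<lambda>l. l * p + c" "\<lambda>s. s div p"])
    fix l assume "l \<in> {..<k}"
    then have "Suc l * p \<le> k * p" by (intro mult_right_mono) auto
    then show "l * p + c \<in> {s. s < k * p \<and> s mod p = c}" using assms by auto
  qed (use assms in \<open>auto simp: less_mult_imp_div_less\<close>)
  finally show ?thesis .
qed

lemma kneading_matrix_finite_order:
  assumes "fib_recurrence_order p k A" "i < p" "j < p"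
  shows "kneading_matrix p A $$ (i, j) = (\<Sum>l<k. fps_const (A l $$ (i, j)) * fps_X ^ l)"
proof (rule fps_ext)
  fix n
  have "fps_nth (\<Sum>l<k. fps_const (A l $$ (i, j)) * fps_X ^ l) n
      = (\<Sum>l<k. if l = n then A l $$ (i, j) else 0)"
    unfolding fps_sum_nth by (intro sum.cong) auto
  \<comment> \<open>For \<open>n < k\<close> only \<open>l = n\<close> contributes; for
    \<open>n \<ge> k\<close> the sum vanishes, and so does \<open>A n\<close>.\<close>
  also have "\<dots> = A n $$ (i, j)"
    using assms by (auto simp: fib_recurrence_order_def)
  finally show "fps_nth (kneading_matrix p A $$ (i, j)) n
      = fps_nth (\<Sum>l<k. fps_const (A l $$ (i, j)) * fps_X ^ l) n"
    using assms by (simp add: kneading_matrix_def)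
qed

lemma mult_geometric_block_mat:
  fixes F :: "complex fps mat"
  assumes "F \<in> carrier_mat n n" "r < n" "c < n"
  shows "((1\<^sub>m n - fps_X \<cdot>\<^sub>m F) * geometric_block_mat n p) $$ (r, c)
       = geometric_block_mat n p $$ (r, c)
         - fps_X * (\<Sum>s<n. F $$ (r, s) * geometric_block_mat n p $$ (s, c))"
proof -
  let ?U = "geometric_block_mat n p"
  have U: "?U \<in> carrier_mat n n" by simp
  have "(1\<^sub>m n - fps_X \<cdot>\<^sub>m F) * ?U = 1\<^sub>m n * ?U - (fps_X \<cdot>\<^sub>m F) * ?U"
    using assms by (intro minus_mult_distrib_mat[OF _ _ U]) auto
  also have "\<dots> = ?U - fps_X \<cdot>\<^sub>m (F * ?U)"
    using assms by (simp add: mult_smult_assoc_mat[OF _ U] left_mult_one_mat[OF U])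
  finally show ?thesis
    using assms carrier_matD[OF U] by (auto simp: scalar_prod_def atLeast0LessThan)
qed

text \<open>Below the first block row, row \<open>r\<close> of the companion matrix has its single 1
  in column \<open>r - p\<close>, which leaves exactly the telescoping difference.\<close>

lemma companion_mult_lower_rows:
  assumes "p \<ge> 1" "p \<le> r" "r < k * p" "c < k * p"
  shows "((1\<^sub>m (k * p) - fps_X \<cdot>\<^sub>m map_mat fps_const (frobenius_companion p k A))
            * geometric_block_mat (k * p) p) $$ (r, c) = (if r = c then 1 else 0)"
proof -
  let ?F = "map_mat fps_const (frobenius_companion p k A)"
  let ?U = "geometric_block_mat (k * p) p"
  have "?F $$ (r, s) = (if s = r - p then 1 else 0)" if "s < k * p" for s
  proof -
    \<comment> \<open>Column \<open>r - p\<close> is the one in the preceding block with the same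
      position inside it; quotient and remainder together determine it.\<close>
    have "r div p = Suc ((r - p) div p)" "r mod p = (r - p) mod p"
      using assms by (auto simp: le_div_geq le_mod_geq)
    then show ?thesis
      using assms that
      by (auto simp: frobenius_companion_def) (metis div_mult_mod_eq)+
  qed
  then have "(\<Sum>s<k * p. ?F $$ (r, s) * ?U $$ (s, c))
           = (\<Sum>s<k * p. if s = r - p then ?U $$ (s, c) else 0)"
    by (intro sum.cong) auto
  also have "\<dots> = ?U $$ (r - p, c)"
    using assms by auto
  finally have sum_eq: "(\<Sum>s<k * p. ?F $$ (r, s) * ?U $$ (s, c)) = ?U $$ (r - p, c)" .
  have "?F \<in> carrier_mat (k * p) (k * p)"
    by (simp add: frobenius_companion_def)
  from mult_geometric_block_mat[OF this assms(3,4), of p]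
    geometric_block_mat_telescope[OF assms]
  show ?thesis by (simp only: sum_eq)
qed

text \<open>The first block column of \<open>geometric_block_mat\<close> stacks the blocks z^l I, so
  the first block row of the companion matrix evaluates against it to the sum of z^l A_l, which is
  the kneading matrix.\<close>

lemma companion_mult_corner:
  assumes "fib_recurrence_order p k A" "r < p" "c < p"
  shows "((1\<^sub>m (k * p) - fps_X \<cdot>\<^sub>m map_mat fps_const (frobenius_companion p k A))
            * geometric_block_mat (k * p) p) $$ (r, c)
       = (1\<^sub>m p - fps_X \<cdot>\<^sub>m kneading_matrix p A) $$ (r, c)"
proof -
  let ?F = "map_mat fps_const (frobenius_companion p k A)"
  let ?U = "geometric_block_mat (k * p) p"
  have "k \<ge> 1"
    using assms by (simp add: fib_recurrence_order_def)
  then have "p \<le> k * p" by simp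
  then have rc: "r < k * p" "c < k * p"
    using assms by (auto intro: less_le_trans)
  let ?f = "\<lambda>s. fps_const (A (s div p) $$ (r, c)) * fps_X ^ (s div p)"
  have "?F $$ (r, s) * ?U $$ (s, c) = (if s mod p = c then ?f s else 0)" if "s < k * p" for s
  proof (cases "s mod p = c")
    case True
    then have "s - c = s div p * p"
      by (metis minus_mod_eq_div_mult)
    then have "(s - c) div p = s div p" "c \<le> s"
      using assms True by auto
    then show ?thesis
      using True that rc assms by (simp add: frobenius_companion_def geometric_block_mat_def)
  next
    case False
    then show ?thesis
      using that rc assms by (simp add: geometric_block_mat_def)
  qed
  then have "(\<Sum>s<k * p. ?F $$ (r, s) * ?U $$ (s, c))
           = (\<Sum>s<k * p. if s mod p = c then ?f s else 0)"
    by (intro sum.cong) auto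
  also have "\<dots> = (\<Sum>l<k. ?f (l * p + c))"
    by (rule sum_lessThan_mult_residue) fact
  also have "\<dots> = kneading_matrix p A $$ (r, c)"
    using assms by (simp add: kneading_matrix_finite_order)
  finally have sum_eq:
    "(\<Sum>s<k * p. ?F $$ (r, s) * ?U $$ (s, c)) = kneading_matrix p A $$ (r, c)" .
  \<comment> \<open>Both indices are below \<open>p\<close>, so equal residues force
    \<open>r = c\<close> and exponent 0.\<close>
  have U_eq: "?U $$ (r, c) = (1\<^sub>m p) $$ (r, c)"
    using rc assms by (simp add: geometric_block_mat_def)
  have "?F \<in> carrier_mat (k * p) (k * p)"
    by (simp add: frobenius_companion_def)
  from mult_geometric_block_mat[OF this rc, of p]
  have "((1\<^sub>m (k * p) - fps_X \<cdot>\<^sub>m ?F) * ?U) $$ (r, c)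
      = (1\<^sub>m p) $$ (r, c) - fps_X * kneading_matrix p A $$ (r, c)"
    by (simp only: sum_eq U_eq)
  also have "\<dots> = (1\<^sub>m p - fps_X \<cdot>\<^sub>m kneading_matrix p A) $$ (r, c)"
    using assms by (simp add: kneading_matrix_def)
  finally show ?thesis .
qed

text \<open>The last \<open>m\<close> rows are those of the identity, so the lower blocks are 0 and
  I. The determinant of a block triangular matrix is the product over its diagonal blocks, whatever
  the upper right block is.\<close>

lemma det_block_upper_unitriangular:
  fixes N K :: "'a :: idom mat"
  assumes N: "N \<in> carrier_mat (p + m) (p + m)" and K: "K \<in> carrier_mat p p"
    and corner: "\<And>r c. r < p \<Longrightarrow> c < p \<Longrightarrow> N $$ (r, c) = K $$ (r, c)"
    and lower: "\<And>r c. p \<le> r \<Longrightarrow> r < p + m \<Longrightarrow> c < p + m \<Longrightarrow>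
      N $$ (r, c) = (if r = c then 1 else 0)"
  shows "det N = det K"
proof -
  let ?B = "mat p m (\<lambda>(i, j). N $$ (i, j + p))"
  have "N = four_block_mat K ?B (0\<^sub>m m p) (1\<^sub>m m)"
    using N K by (intro eq_matI) (auto simp: corner lower)
  then show ?thesis
    using det_four_block_mat_lower_left_zero[OF K, of ?B m "0\<^sub>m m p" "1\<^sub>m m"] by simp
qed

theorem theorem1:
  fixes p k :: nat and A :: "nat \<Rightarrow> complex mat"
  assumes "p \<ge> 1" and "k \<ge> 1"
    and "fib_recurrence_order p k A"
  shows "det (1\<^sub>m (k * p) - fps_X \<cdot>\<^sub>m map_mat fps_const (frobenius_companion p k A))
       = det (1\<^sub>m p - fps_X \<cdot>\<^sub>m kneading_matrix p A)"
proof -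
  let ?M = "1\<^sub>m (k * p) - fps_X \<cdot>\<^sub>m map_mat fps_const (frobenius_companion p k A)"
  let ?U = "geometric_block_mat (k * p) p"
  have "p \<le> k * p" using assms by simp
  \<comment> \<open>Splits off the first block; \<open>p \<le> k * p\<close> keeps the subtraction
    on naturals from truncating.\<close>
  then have kp: "p + (k * p - p) = k * p" by simp
  have M: "?M \<in> carrier_mat (k * p) (k * p)"
    by (auto simp: frobenius_companion_def)
  have U: "?U \<in> carrier_mat (k * p) (k * p)" by simp
  have "det (?M * ?U) = det (1\<^sub>m p - fps_X \<cdot>\<^sub>m kneading_matrix p A)"
  proof (rule det_block_upper_unitriangular[where p = p and m = "k * p - p"], unfold kp)
    show "?M * ?U \<in> carrier_mat (k * p) (k * p)"
      using M U by (rule mult_carrier_mat)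
    show "1\<^sub>m p - fps_X \<cdot>\<^sub>m kneading_matrix p A \<in> carrier_mat p p"
      by (auto simp: kneading_matrix_def)
  qed (rule companion_mult_corner companion_mult_lower_rows assms | assumption)+
  moreover have "det (?M * ?U) = det ?M * det ?U"
    using M U by (rule det_mult)
  ultimately show ?thesis
    by (simp add: det_geometric_block_mat)
qed

end
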